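(* Assume that $\rho_0\in\mathbb{C}^{m\times m}$ is Hermitian and positive semidefinite. Then, for any time step size $\tau>0$, every element $\rho_n$ of the solution $\{\rho_n\}_{n=0}^N$ of the full-rank exponential Euler scheme $$\rho_{n+1}=e^{\tau A}\rho_n e^{\tau A^{\dagger}}+\sum_{k=1}^K\gamma_k\int_0^{\tau}L_k e^{sA}\rho_n e^{sA^{\dagger}}L_k^{\dagger}\,ds,\qquad 0\le n\le N-1,$$ is Hermitian and positive semidefinite.
   Context: $m,K,N$ are positive integers; $H\in\mathbb{C}^{m\times m}$ is Hermitian; $L_1,\dots,L_K\in\mathbb{C}^{m\times m}$ are arbitrary matrices; $\gamma_1,\dots,\gamma_K\ge 0$ are real. The superscript $\dagger$ denotes the conjugate transpose. The matrix $A$ is $$A=-iH-\frac12\sum_{k=1}^K\gamma_k L_k^{\dagger}L_k .$$ The scheme is a time discretization of the Lindblad equation $\dot\rho=-i[H,\rho]+\sum_{k=1}^K\gamma_k\left(L_k\rho L_k^{\dagger}-\frac12\{L_k^{\dagger}L_k,\rho\}\right)$ with step size $\tau=T/N$ on $[0,T]$. *)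

theory Defs
  imports "HOL-Analysis.Analysis"
begin

definition conj_transpose :: "complex^'n^'m \<Rightarrow> complex^'m^'n" where
  "conj_transpose M = (\<chi> i j. cnj (M $ j $ i))"

definition hermitian_matrix :: "complex^'m^'m \<Rightarrow> bool" where
  "hermitian_matrix M \<longleftrightarrow> conj_transpose M = M"

definition pos_semidef :: "complex^'m^'m \<Rightarrow> bool" where
  "pos_semidef M \<longleftrightarrow>
     (\<forall>v. (\<Sum>i\<in>UNIV. cnj (v $ i) * (M *v v) $ i) \<in> \<real>\<^sub>\<ge>\<^sub>0)"

(* The library's exp and (^) cannot be used on complex^'m^'m: multiplication in the
   type class instances for vec is componentwise, whereas the matrix product is (**). *)
definition matrix_power :: "complex^'m^'m \<Rightarrow> nat \<Rightarrow> complex^'m^'m" where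
  "matrix_power M n = (((**) M) ^^ n) (mat 1)"

definition matrix_exp :: "complex^'m^'m \<Rightarrow> complex^'m^'m" where
  "matrix_exp M = (\<Sum>n. (1 / fact n) *\<^sub>R matrix_power M n)"

(* mat c is c times the identity, so the first summand is -iH. *)
definition effective_generator ::
  "complex^'m^'m \<Rightarrow> nat \<Rightarrow> (nat \<Rightarrow> complex^'m^'m) \<Rightarrow> (nat \<Rightarrow> real) \<Rightarrow> complex^'m^'m" where
  "effective_generator H K L \<gamma> =
     mat (- \<i>) ** H - (1/2) *\<^sub>R (\<Sum>k=1..K. \<gamma> k *\<^sub>R (conj_transpose (L k) ** L k))"

(* Only the values rho 0, ..., rho N are constrained. *)
definition exp_euler_solution ::
  "complex^'m^'m \<Rightarrow> nat \<Rightarrow> (nat \<Rightarrow> complex^'m^'m) \<Rightarrow> (nat \<Rightarrow> real) \<Rightarrow> real \<Rightarrow> nat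
     \<Rightarrow> complex^'m^'m \<Rightarrow> (nat \<Rightarrow> complex^'m^'m) \<Rightarrow> bool" where
  "exp_euler_solution H K L \<gamma> \<tau> N \<rho>\<^sub>0 \<rho> \<longleftrightarrow>
     (let A = effective_generator H K L \<gamma> in
        \<rho> 0 = \<rho>\<^sub>0 \<and>
        (\<forall>n<N. \<rho> (Suc n) =
           matrix_exp (\<tau> *\<^sub>R A) ** \<rho> n ** matrix_exp (\<tau> *\<^sub>R conj_transpose A)
           + (\<Sum>k=1..K. \<gamma> k *\<^sub>R
                integral {0..\<tau>} (\<lambda>s. L k ** matrix_exp (s *\<^sub>R A) ** \<rho> n
                  ** matrix_exp (s *\<^sub>R conj_transpose A) ** conj_transpose (L k)))))"

end

theory Submission
  imports Defs
begin

text \<open>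
  One step of the scheme is a completely positive map. Writing \<open>E s\<close> for the exponential of
  \<open>s A\<close>, the exponential of \<open>s A\<^sup>\<dagger>\<close> is the conjugate transpose of \<open>E s\<close>
  (\<open>matrix_exp_conj_transpose\<close>), so every term of the step is a congruence \<open>X \<rho> X\<^sup>\<dagger>\<close>: with
  \<open>X = E \<tau>\<close> for the first term and \<open>X = L k ** E s\<close> under the integral. A congruence maps the
  set of Hermitian positive semidefinite matrices to itself, because the quadratic form of
  \<open>X \<rho> X\<^sup>\<dagger>\<close> at \<open>v\<close> is that of \<open>\<rho>\<close> at \<open>X\<^sup>\<dagger> v\<close> (\<open>psd_cone_congruence\<close>). This set is moreover
  a convex cone cut out by real linear conditions, so it also absorbs sums, nonnegative
  multiples and integrals (\<open>psd_cone_integral\<close>). Induction over the steps finishes the proof.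
\<close>

section \<open>Conjugate transposition\<close>

lemma conj_transpose_conj_transpose [simp]: "conj_transpose (conj_transpose M) = M"
  by (simp add: conj_transpose_def vec_eq_iff)

lemma conj_transpose_mult:
  "conj_transpose (M ** P) = conj_transpose P ** conj_transpose M"
  by (simp add: conj_transpose_def matrix_matrix_mult_def vec_eq_iff mult.commute)

lemma conj_transpose_mat_1 [simp]: "conj_transpose (mat 1) = mat 1"
  by (auto simp: conj_transpose_def mat_def vec_eq_iff)

lemma conj_transpose_add: "conj_transpose (M + P) = conj_transpose M + conj_transpose P"
  by (simp add: conj_transpose_def vec_eq_iff)

lemma conj_transpose_scaleR: "conj_transpose (r *\<^sub>R M) = r *\<^sub>R conj_transpose M"
  by (simp add: conj_transpose_def vec_eq_iff)

lemma bounded_linear_conj_transpose: "bounded_linear conj_transpose"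
  unfolding linear_conv_bounded_linear [symmetric]
  by (rule linearI) (simp_all add: conj_transpose_add conj_transpose_scaleR)

section \<open>The matrix exponential of a conjugate transpose\<close>

lemma matrix_power_0 [simp]: "matrix_power M 0 = mat 1"
  by (simp add: matrix_power_def)

lemma matrix_power_Suc: "matrix_power M (Suc n) = M ** matrix_power M n"
  by (simp add: matrix_power_def)

lemma matrix_power_Suc_right: "matrix_power M (Suc n) = matrix_power M n ** M"
proof (induction n)
  case 0
  show ?case by (simp add: matrix_power_Suc)
next
  case (Suc n)
  then show ?case by (metis matrix_power_Suc matrix_mul_assoc)
qed

lemma conj_transpose_matrix_power:
  "conj_transpose (matrix_power M n) = matrix_power (conj_transpose M) n"
proof (induction n)
  case (Suc n)
  have "conj_transpose (matrix_power M (Suc n)) = conj_transpose (matrix_power M n) ** conj_transpose M"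
    by (simp add: matrix_power_Suc conj_transpose_mult)
  then show ?case
    by (simp add: Suc.IH matrix_power_Suc_right)
qed simp

lemma bounded_bilinear_matrix_mult:
  "bounded_bilinear ((**) :: complex^'n^'m \<Rightarrow> complex^'p^'n \<Rightarrow> complex^'p^'m)"
  unfolding bilinear_conv_bounded_bilinear [symmetric]
  by (auto simp: bilinear_def linear_iff matrix_matrix_mult_def vec_eq_iff
      algebra_simps sum.distrib scaleR_sum_right)

text \<open>
  Matrix multiplication is bilinear in finite dimension, hence bounded with some constant \<open>C\<close>.
  So the powers of \<open>M\<close> grow at most geometrically with ratio \<open>norm M * C\<close>, and a multiple of
  the real exponential series dominates.
\<close>

lemma summable_matrix_exp:
  fixes M :: "complex^'m^'m"
  shows "summable (\<lambda>n. (1 / fact n) *\<^sub>R matrix_power M n)"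
proof -
  obtain C where C: "C \<ge> 0"
    "\<And>(P :: complex^'m^'m) (Q :: complex^'m^'m). norm (P ** Q) \<le> norm P * norm Q * C"
    using bounded_bilinear.nonneg_bounded [OF bounded_bilinear_matrix_mult] by blast
  define r where "r = norm M * C"
  define c where "c = norm (mat 1 :: complex^'m^'m)"
  have "r \<ge> 0" using C(1) by (simp add: r_def)
  have power_bound: "norm (matrix_power M n) \<le> r ^ n * c" for n
  proof (induction n)
    case (Suc n)
    have "norm (matrix_power M (Suc n)) \<le> r * norm (matrix_power M n)"
      using C(2) [of M "matrix_power M n"] by (simp add: matrix_power_Suc r_def mult_ac)
    also have "\<dots> \<le> r * (r ^ n * c)"
      using Suc.IH \<open>r \<ge> 0\<close> by (rule mult_left_mono)
    finally show ?case by (simp add: mult.assoc)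
  qed (simp add: c_def)
  have "summable (\<lambda>n. inverse (fact n) * r ^ n * c)"
    by (intro summable_mult2 summable_exp)
  then show ?thesis
  proof (rule summable_comparison_test' [where N = 0])
    fix n
    show "norm ((1 / fact n) *\<^sub>R matrix_power M n) \<le> inverse (fact n) * r ^ n * c"
      using power_bound [of n] by (simp add: divide_simps mult.assoc)
  qed
qed

lemma matrix_exp_conj_transpose:
  "matrix_exp (conj_transpose M) = conj_transpose (matrix_exp M)"
  unfolding matrix_exp_def
  by (simp add: bounded_linear.suminf [OF bounded_linear_conj_transpose summable_matrix_exp]
      conj_transpose_scaleR conj_transpose_matrix_power)

section \<open>The cone of Hermitian positive semidefinite matrices\<close>

definition quad_form :: "complex^'m \<Rightarrow> complex^'m^'m \<Rightarrow> complex" where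
  "quad_form v M = (\<Sum>i\<in>UNIV. cnj (v $ i) * (M *v v) $ i)"

definition psd_cone :: "(complex^'m^'m) set" where
  "psd_cone = {M. hermitian_matrix M \<and> pos_semidef M}"

lemma psd_cone_iff:
  "M \<in> psd_cone \<longleftrightarrow>
     conj_transpose M = M \<and> (\<forall>v. Re (quad_form v M) \<ge> 0 \<and> Im (quad_form v M) = 0)"
  by (simp add: psd_cone_def hermitian_matrix_def pos_semidef_def quad_form_def
      complex_nonneg_Reals_iff)

lemma quad_form_add: "quad_form v (M + P) = quad_form v M + quad_form v P"
  by (simp add: quad_form_def matrix_vector_mult_add_rdistrib distrib_left sum.distrib)

lemma quad_form_scaleR: "quad_form v (r *\<^sub>R M) = r *\<^sub>R quad_form v M"
proof -
  have "(r *\<^sub>R M) *v v = r *\<^sub>R (M *v v)"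
    by (simp add: matrix_vector_mult_def vec_eq_iff scaleR_sum_right)
  then show ?thesis by (simp add: quad_form_def scaleR_sum_right)
qed

lemma bounded_linear_quad_form: "bounded_linear (quad_form v)"
  unfolding linear_conv_bounded_linear [symmetric]
  by (rule linearI) (simp_all add: quad_form_add quad_form_scaleR)

lemma sesquilinear_adjoint:
  fixes X :: "complex^'n^'m"
  shows "(\<Sum>i\<in>UNIV. cnj (v $ i) * (X *v u) $ i)
       = (\<Sum>j\<in>UNIV. cnj ((conj_transpose X *v v) $ j) * u $ j)"
proof -
  have "(\<Sum>i\<in>UNIV. cnj (v $ i) * (X *v u) $ i)
      = (\<Sum>i\<in>UNIV. \<Sum>j\<in>UNIV. cnj (v $ i) * (X $ i $ j * u $ j))"
    by (simp add: matrix_vector_mult_def sum_distrib_left)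
  also have "\<dots> = (\<Sum>j\<in>UNIV. \<Sum>i\<in>UNIV. cnj (v $ i) * (X $ i $ j * u $ j))"
    by (rule sum.swap)
  also have "\<dots> = (\<Sum>j\<in>UNIV. cnj ((conj_transpose X *v v) $ j) * u $ j)"
    by (simp add: matrix_vector_mult_def conj_transpose_def sum_distrib_left mult_ac)
  finally show ?thesis .
qed

lemma quad_form_congruence:
  "quad_form v (X ** M ** conj_transpose X) = quad_form (conj_transpose X *v v) M"
  by (simp add: quad_form_def sesquilinear_adjoint
      flip: matrix_vector_mul_assoc)

lemma psd_cone_congruence:
  "M \<in> psd_cone \<Longrightarrow> X ** M ** conj_transpose X \<in> psd_cone"
  by (simp add: psd_cone_iff quad_form_congruence conj_transpose_mult matrix_mul_assoc)

lemma psd_cone_add: "M \<in> psd_cone \<Longrightarrow> P \<in> psd_cone \<Longrightarrow> M + P \<in> psd_cone"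
  by (simp add: psd_cone_iff quad_form_add conj_transpose_add)

lemma psd_cone_scaleR: "r \<ge> 0 \<Longrightarrow> M \<in> psd_cone \<Longrightarrow> r *\<^sub>R M \<in> psd_cone"
  by (simp add: psd_cone_iff quad_form_scaleR conj_transpose_scaleR)

lemma psd_cone_0: "0 \<in> psd_cone"
  by (simp add: psd_cone_iff quad_form_def conj_transpose_def vec_eq_iff)

lemma psd_cone_sum:
  "(\<And>k. k \<in> I \<Longrightarrow> f k \<in> psd_cone) \<Longrightarrow> (\<Sum>k\<in>I. f k) \<in> psd_cone"
  by (induction I rule: infinite_finite_induct) (simp_all add: psd_cone_0 psd_cone_add)

text \<open>
  The cone is described by bounded real linear maps (conjugate transposition, and the real and
  imaginary parts of the quadratic forms), and these commute with the integral. A function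
  that is not integrable has integral zero by convention, and zero lies in the cone as well.
\<close>

lemma psd_cone_integral:
  fixes f :: "'a::euclidean_space \<Rightarrow> complex^'m^'m"
  assumes f: "\<And>s. s \<in> S \<Longrightarrow> f s \<in> psd_cone"
  shows "integral S f \<in> psd_cone"
proof (cases "f integrable_on S")
  case False
  then show ?thesis by (simp add: not_integrable_integral psd_cone_0)
next
  case True
  note commute = integral_linear [OF True, unfolded o_def, symmetric]
  have "conj_transpose (integral S f) = integral S (\<lambda>s. conj_transpose (f s))"
    by (rule commute [OF bounded_linear_conj_transpose])
  also have "\<dots> = integral S f"
    using f by (intro integral_cong) (simp add: psd_cone_iff)
  finally have hermitian: "conj_transpose (integral S f) = integral S f" .
  have "Re (quad_form v (integral S f)) \<ge> 0 \<and> Im (quad_form v (integral S f)) = 0" for v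
  proof
    have Re_linear: "bounded_linear (\<lambda>M. Re (quad_form v M))"
      by (rule bounded_linear_compose [OF bounded_linear_Re bounded_linear_quad_form])
    have "integral S (\<lambda>s. Re (quad_form v (f s))) \<ge> 0"
      using integrable_linear [OF True Re_linear] f
      by (intro integral_nonneg) (simp_all add: o_def psd_cone_iff)
    then show "Re (quad_form v (integral S f)) \<ge> 0"
      by (simp add: commute [OF Re_linear])
    have Im_linear: "bounded_linear (\<lambda>M. Im (quad_form v M))"
      by (rule bounded_linear_compose [OF bounded_linear_Im bounded_linear_quad_form])
    have "integral S (\<lambda>s. Im (quad_form v (f s))) = integral S (\<lambda>s. 0)"
      using f by (intro integral_cong) (simp add: psd_cone_iff)
    then show "Im (quad_form v (integral S f)) = 0"
      by (simp add: commute [OF Im_linear])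
  qed
  with hermitian show ?thesis by (simp add: psd_cone_iff)
qed

section \<open>Positivity of the scheme\<close>

lemma matrix_exp_scaleR_conj_transpose:
  "matrix_exp (s *\<^sub>R conj_transpose A) = conj_transpose (matrix_exp (s *\<^sub>R A))"
  by (simp add: conj_transpose_scaleR flip: matrix_exp_conj_transpose)

lemma psd_cone_exp_euler_step:
  assumes \<gamma>: "\<And>k. k \<in> {1..K} \<Longrightarrow> \<gamma> k \<ge> 0" and R: "R \<in> psd_cone"
  shows "matrix_exp (\<tau> *\<^sub>R A) ** R ** matrix_exp (\<tau> *\<^sub>R conj_transpose A)
           + (\<Sum>k=1..K. \<gamma> k *\<^sub>R
                integral {0..\<tau>} (\<lambda>s. L k ** matrix_exp (s *\<^sub>R A) ** R
                  ** matrix_exp (s *\<^sub>R conj_transpose A) ** conj_transpose (L k))) \<in> psd_cone"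
proof -
  have "L k ** matrix_exp (s *\<^sub>R A) ** R
          ** matrix_exp (s *\<^sub>R conj_transpose A) ** conj_transpose (L k) \<in> psd_cone" for k s
    using psd_cone_congruence [OF R, of "L k ** matrix_exp (s *\<^sub>R A)"]
    by (simp add: matrix_exp_scaleR_conj_transpose conj_transpose_mult matrix_mul_assoc)
  moreover have "matrix_exp (\<tau> *\<^sub>R A) ** R ** matrix_exp (\<tau> *\<^sub>R conj_transpose A) \<in> psd_cone"
    using psd_cone_congruence [OF R] by (simp add: matrix_exp_scaleR_conj_transpose)
  ultimately show ?thesis
    using \<gamma> by (intro psd_cone_add psd_cone_sum psd_cone_scaleR psd_cone_integral)
qed

theorem theorem3p1:
  fixes H :: "complex^'m^'m"
    and L :: "nat \<Rightarrow> complex^'m^'m"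
    and \<gamma> :: "nat \<Rightarrow> real"
    and K N :: nat
    and \<tau> :: real
    and \<rho>\<^sub>0 :: "complex^'m^'m"
    and \<rho> :: "nat \<Rightarrow> complex^'m^'m"
  assumes "K \<ge> 1" and "N \<ge> 1"
    and "hermitian_matrix H"
    and "\<And>k. k \<in> {1..K} \<Longrightarrow> \<gamma> k \<ge> 0"
    and "hermitian_matrix \<rho>\<^sub>0" and "pos_semidef \<rho>\<^sub>0"
    and "\<tau> > 0"
    and "exp_euler_solution H K L \<gamma> \<tau> N \<rho>\<^sub>0 \<rho>"
  shows "\<forall>n\<le>N. hermitian_matrix (\<rho> n) \<and> pos_semidef (\<rho> n)"
proof -
  have "\<rho> n \<in> psd_cone" if "n \<le> N" for n
    using that
  proof (induction n)
    case 0
    show ?case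
      using assms(5,6,8) by (simp add: exp_euler_solution_def Let_def psd_cone_def)
  next
    case (Suc n)
    then have "\<rho> n \<in> psd_cone" by simp
    with assms(4) have step: "matrix_exp (\<tau> *\<^sub>R A) ** \<rho> n ** matrix_exp (\<tau> *\<^sub>R conj_transpose A)
           + (\<Sum>k=1..K. \<gamma> k *\<^sub>R
                integral {0..\<tau>} (\<lambda>s. L k ** matrix_exp (s *\<^sub>R A) ** \<rho> n
                  ** matrix_exp (s *\<^sub>R conj_transpose A) ** conj_transpose (L k))) \<in> psd_cone" for A
      by (rule psd_cone_exp_euler_step)
    show ?case
      using assms(8) Suc.prems step [of "effective_generator H K L \<gamma>"]
      by (simp add: exp_euler_solution_def Let_def)
  qed
  then show ?thesis by (simp add: psd_cone_def)
qed

end
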